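(* For any $x\ge0$, we have $$\sum_{n=-\infty}^\infty e^{-2x}I_n(2x)\,n^2=2x .$$
   Context: $I_n$ denotes the modified Bessel function of the first kind of integer order $n$. *)

theory Defs
  imports "HOL-Analysis.Analysis"
begin

text \<open>
  The modified Bessel function of the first kind of integer order, by its power series
  \<open>I\<^sub>n(x) = \<Sum>\<^sub>m (x/2)^(2m+n) / (m! \<Gamma>(m+n+1))\<close>. For negative \<open>n\<close> the terms with
  \<open>m + n + 1 \<le> 0\<close> vanish because the reciprocal Gamma function \<open>rGamma\<close> is zero at the
  nonpositive integers. These include all terms with a negative exponent, so the value at
  \<open>x = 0\<close> is also the usual one.
\<close>

definition bessel_I :: "int \<Rightarrow> real \<Rightarrow> real" where
  "bessel_I n x =
     (\<Sum>m. (x / 2) powi (2 * int m + n) * rGamma (real_of_int (int m + n + 1)) / fact m)"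

end

theory Submission imports Defs begin

text \<open>
  The number \<open>bessel_I n (2 * x)\<close> is the convolution \<open>\<Sum>k. p (n + k) * p k\<close> of the
  exponential weights \<open>p j = x ^ j / j!\<close>. With the factor \<open>exp (- 2 * x)\<close> it becomes the
  probability that \<open>J - K = n\<close> for independent Poisson variables \<open>J\<close> and \<open>K\<close> of mean \<open>x\<close>
  (the Skellam distribution). The claim is therefore that \<open>J - K\<close>, which has mean zero, has
  variance \<open>x + x = 2 * x\<close>.

  The weights are extended by zero to the integers. Then the recurrence
  \<open>j * p j = x * p (j - 1)\<close> holds without boundary cases, and shifting the summation index yields
  the moments of \<open>p\<close> (\<open>exp_weight_first_moment\<close>, \<open>exp_weight_second_moment\<close>). Expanding the
  square gives \<open>\<Sum>(j, k). (j - k)\<^sup>2 * p j * p k = 2 * x * exp (2 * x)\<close>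
  (\<open>exp_weight_square_difference\<close>), and the shear \<open>(n, k) \<mapsto> (n + k, k)\<close> of the integer plane
  turns this double sum into the sum over \<open>n\<close> of \<open>n\<^sup>2\<close> times the convolution
  (\<open>bessel_I_convolution\<close>).
\<close>

definition exp_weight :: "real \<Rightarrow> int \<Rightarrow> real" where
  "exp_weight x n = (if n < 0 then 0 else x ^ nat n / fact (nat n))"

lemma has_sum_over_nonneg_ints:
  fixes f :: "int \<Rightarrow> 'a :: {comm_monoid_add, topological_space}"
  assumes "\<And>n. n < 0 \<Longrightarrow> f n = 0"
  shows "(f has_sum s) UNIV \<longleftrightarrow> ((\<lambda>k. f (int k)) has_sum s) UNIV"
proof -
  have "(f has_sum s) UNIV \<longleftrightarrow> (f has_sum s) {0..}"
    by (rule has_sum_cong_neutral) (use assms in auto)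
  also have "\<dots> \<longleftrightarrow> ((\<lambda>k. f (int k)) has_sum s) UNIV"
    by (rule has_sum_reindex_bij_witness[of _ int nat]) auto
  finally show ?thesis .
qed

lemma exp_weight_total:
  assumes "x \<ge> 0"
  shows "(exp_weight x has_sum exp x) UNIV"
proof -
  have "((\<lambda>k. x ^ k / fact k) has_sum exp x) UNIV"
    using exp_converges[of x] assms
    by (intro sums_nonneg_imp_has_sum) (auto simp: divide_inverse mult.commute)
  then show ?thesis
    by (subst has_sum_over_nonneg_ints) (auto simp: exp_weight_def)
qed

lemma exp_weight_recurrence: "of_int n * exp_weight x n = x * exp_weight x (n - 1)"
proof (cases "n > 0")
  case True
  then obtain m where n: "n = int (Suc m)"
    by (metis gr0_implies_Suc zero_less_imp_eq_int)
  then have "exp_weight x n = x * x ^ m / (real (Suc m) * fact m)"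
      and "exp_weight x (n - 1) = x ^ m / fact m"
    by (simp_all add: exp_weight_def nat_add_distrib)
  then show ?thesis
    by (simp add: n del: of_nat_Suc)
qed (auto simp: exp_weight_def)

lemma has_sum_shift_int:
  "((\<lambda>n::int. f (n - 1)) has_sum s) UNIV \<longleftrightarrow> (f has_sum s) UNIV"
  by (rule has_sum_reindex_bij_witness[of _ "\<lambda>n. n + 1" "\<lambda>n. n - 1"]) auto

lemma exp_weight_first_moment:
  assumes "x \<ge> 0"
  shows "((\<lambda>n. of_int n * exp_weight x n) has_sum (x * exp x)) UNIV"
  unfolding exp_weight_recurrence
  by (intro has_sum_cmult_right) (simp add: has_sum_shift_int exp_weight_total assms)

text \<open>The recurrence leaves the factor \<open>n\<close> of \<open>n\<^sup>2\<close> as \<open>(n - 1) + 1\<close> in terms of the shifted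
  index, so the second moment reduces to the first moment and the total.\<close>
lemma exp_weight_second_moment:
  assumes "x \<ge> 0"
  shows "((\<lambda>n. (of_int n)\<^sup>2 * exp_weight x n) has_sum ((x\<^sup>2 + x) * exp x)) UNIV"
proof -
  have "((\<lambda>n. of_int n * exp_weight x n + exp_weight x n) has_sum (x * exp x + exp x)) UNIV"
    by (intro has_sum_add exp_weight_first_moment exp_weight_total assms)
  then have "((\<lambda>n. x * (of_int (n - 1) * exp_weight x (n - 1) + exp_weight x (n - 1)))
      has_sum (x * (x * exp x + exp x))) UNIV"
    by (intro has_sum_cmult_right) (subst has_sum_shift_int)
  moreover have "x * (of_int (n - 1) * exp_weight x (n - 1) + exp_weight x (n - 1))
      = (of_int n)\<^sup>2 * exp_weight x n" for n
  proof -
    have "(of_int n)\<^sup>2 * exp_weight x n = of_int n * (x * exp_weight x (n - 1))"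
      unfolding exp_weight_recurrence[symmetric] by (simp add: power2_eq_square)
    then show ?thesis
      by (simp add: algebra_simps)
  qed
  moreover have "x * (x * exp x + exp x) = (x\<^sup>2 + x) * exp x"
    by (simp add: algebra_simps power2_eq_square)
  ultimately show ?thesis
    by (simp only:)
qed

text \<open>Unconditional convergence of real series is absolute, which makes the family of all
  products summable; its sum can then be computed row by row.\<close>
lemma has_sum_times_real:
  fixes f :: "'a \<Rightarrow> real" and g :: "'b \<Rightarrow> real"
  assumes f: "(f has_sum a) A" and g: "(g has_sum b) B"
  shows "((\<lambda>(i, k). f i * g k) has_sum (a * b)) (A \<times> B)"
proof (rule has_sum_SigmaI)
  show "((\<lambda>k. case (i, k) of (i, k) \<Rightarrow> f i * g k) has_sum (f i * b)) B" for i
    using has_sum_cmult_right[OF g] by simp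
  show "((\<lambda>i. f i * b) has_sum (a * b)) A"
    by (rule has_sum_cmult_left[OF f])
  have f': "(\<lambda>i. \<bar>f i\<bar>) summable_on A" and g': "(\<lambda>k. \<bar>g k\<bar>) summable_on B"
    using summable_on_iff_abs_summable_on_real[THEN iffD1, OF has_sum_imp_summable, OF f]
      summable_on_iff_abs_summable_on_real[THEN iffD1, OF has_sum_imp_summable, OF g]
    by simp_all
  have "(\<lambda>(i, k). \<bar>f i\<bar> * \<bar>g k\<bar>) summable_on (A \<times> B)"
  proof (rule summable_on_SigmaI)
    show "((\<lambda>k. case (i, k) of (i, k) \<Rightarrow> \<bar>f i\<bar> * \<bar>g k\<bar>) has_sum
        (\<bar>f i\<bar> * (\<Sum>\<^sub>\<infinity>k\<in>B. \<bar>g k\<bar>))) B" for i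
      using has_sum_cmult_right[OF has_sum_infsum[OF g']] by simp
    show "(\<lambda>i. \<bar>f i\<bar> * (\<Sum>\<^sub>\<infinity>k\<in>B. \<bar>g k\<bar>)) summable_on A"
      by (rule summable_on_cmult_left[OF f'])
  qed simp
  then have "(\<lambda>ik. norm (case ik of (i, k) \<Rightarrow> f i * g k)) summable_on (A \<times> B)"
    by (simp add: case_prod_unfold abs_mult)
  then show "(\<lambda>(i, k). f i * g k) summable_on (A \<times> B)"
    by (rule abs_summable_summable)
qed

lemma exp_weight_square_difference:
  assumes "x \<ge> 0"
  shows "((\<lambda>(j, k). (of_int (j - k))\<^sup>2 * (exp_weight x j * exp_weight x k))
    has_sum (2 * x * exp (2 * x))) (UNIV \<times> UNIV)"
proof -
  let ?p = "exp_weight x"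
  note moments = exp_weight_total[OF assms] exp_weight_first_moment[OF assms]
    exp_weight_second_moment[OF assms]
  have "((\<lambda>jk. (case jk of (j, k) \<Rightarrow> (of_int j)\<^sup>2 * ?p j * ?p k)
       + (case jk of (j, k) \<Rightarrow> ?p j * ((of_int k)\<^sup>2 * ?p k))
       + (- 2) * (case jk of (j, k) \<Rightarrow> of_int j * ?p j * (of_int k * ?p k)))
     has_sum ((x\<^sup>2 + x) * exp x * exp x + exp x * ((x\<^sup>2 + x) * exp x)
       + (- 2) * (x * exp x * (x * exp x)))) (UNIV \<times> UNIV)"
    by (intro has_sum_add has_sum_cmult_right has_sum_times_real moments)
  also have "(x\<^sup>2 + x) * exp x * exp x + exp x * ((x\<^sup>2 + x) * exp x)
       + (- 2) * (x * exp x * (x * exp x)) = 2 * x * (exp x * exp x)"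
    by (simp add: algebra_simps power2_eq_square)
  also have "exp x * exp x = exp (2 * x)"
    by (simp flip: exp_add)
  finally show ?thesis
    by (rule has_sum_cong[THEN iffD1, rotated])
      (auto simp: algebra_simps power2_eq_square)
qed

text \<open>The Bessel term with exponent \<open>2 * k + n\<close> is the product of the weights at \<open>n + k\<close>
  and \<open>k\<close>. Where \<open>n + k\<close> is negative, the reciprocal Gamma function supplies the same zero
  as the extension of the weights.\<close>
lemma bessel_I_term:
  "x powi (2 * int k + n) * rGamma (real_of_int (int k + n + 1)) / fact k
    = exp_weight x (n + int k) * exp_weight x (int k)"
proof (cases "n + int k < 0")
  case True
  then show ?thesis
    unfolding rGamma_of_int by (simp add: exp_weight_def)
next
  case False
  then obtain j where j: "n + int k = int j"
    by (metis nonneg_int_cases not_less)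
  then have "2 * int k + n = int (j + k)" and "int k + n + 1 = int j + 1"
    by simp_all
  then have "x powi (2 * int k + n) = x ^ (j + k)"
      and "rGamma (real_of_int (int k + n + 1)) = inverse (fact j)"
    by (simp_all only: power_int_of_nat rGamma_of_int) simp
  then show ?thesis
    unfolding j by (simp add: exp_weight_def power_add divide_inverse)
qed

lemma bessel_I_convolution:
  assumes "x \<ge> 0"
  shows "((\<lambda>k. exp_weight x (n + k) * exp_weight x k) has_sum bessel_I n (2 * x)) UNIV"
proof -
  let ?c = "\<lambda>k. exp_weight x (n + k) * exp_weight x k"
  \<comment> \<open>The convolution series is one line of the convergent double series of all products.\<close>
  have "(\<lambda>(j, k). exp_weight x j * exp_weight x k) summable_on (UNIV \<times> UNIV)"
    using has_sum_times_real[OF exp_weight_total exp_weight_total] assms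
    by (auto simp: summable_on_def)
  then have "(\<lambda>(j, k). exp_weight x j * exp_weight x k) summable_on range (\<lambda>k. (n + k, k))"
    by (rule summable_on_subset_banach) auto
  then have "?c summable_on UNIV"
    by (subst (asm) summable_on_reindex) (auto simp: inj_on_def o_def)
  then obtain s where s: "(?c has_sum s) UNIV"
    by (auto simp: summable_on_def)
  then have "((\<lambda>k. ?c (int k)) has_sum s) UNIV"
    by (subst (asm) has_sum_over_nonneg_ints) (auto simp: exp_weight_def)
  then have "(\<lambda>k. ?c (int k)) sums s"
    by (rule has_sum_imp_sums)
  moreover have "bessel_I n (2 * x) = (\<Sum>k. ?c (int k))"
    unfolding bessel_I_def bessel_I_term by simp
  ultimately have "bessel_I n (2 * x) = s"
    by (simp add: sums_iff)
  with s show ?thesis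
    by simp
qed

theorem proposition8p5:
  fixes x :: real
  assumes "x \<ge> 0"
  shows "((\<lambda>n::int. exp (- 2 * x) * bessel_I n (2 * x) * (real_of_int n)\<^sup>2) has_sum (2 * x)) UNIV"
proof -
  let ?p = "exp_weight x"
  have "((\<lambda>(n, k). (of_int n)\<^sup>2 * (?p (n + k) * ?p k)) has_sum (2 * x * exp (2 * x)))
      (UNIV \<times> UNIV)
    \<longleftrightarrow> ((\<lambda>(j, k). (of_int (j - k))\<^sup>2 * (?p j * ?p k)) has_sum (2 * x * exp (2 * x)))
      (UNIV \<times> UNIV)"
    by (rule has_sum_reindex_bij_witness[of _ "\<lambda>(j, k). (j - k, k)" "\<lambda>(n, k). (n + k, k)"]) auto
  then have "((\<lambda>(n, k). (of_int n)\<^sup>2 * (?p (n + k) * ?p k)) has_sum (2 * x * exp (2 * x)))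
      (UNIV \<times> UNIV)"
    using exp_weight_square_difference[OF assms] by blast
  then have "((\<lambda>n. (of_int n)\<^sup>2 * bessel_I n (2 * x)) has_sum (2 * x * exp (2 * x))) UNIV"
    by (rule has_sum_SigmaD)
      (auto intro!: has_sum_cmult_right bessel_I_convolution assms)
  then have "((\<lambda>n. exp (- 2 * x) * ((of_int n)\<^sup>2 * bessel_I n (2 * x)))
      has_sum (exp (- 2 * x) * (2 * x * exp (2 * x)))) UNIV"
    by (rule has_sum_cmult_right)
  also have "exp (- 2 * x) * (2 * x * exp (2 * x)) = 2 * x"
    by (simp add: exp_minus)
  finally show ?thesis
    by (simp add: mult_ac)
qed

end
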